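(* Let $K$ be a semiring of characteristic $0$. Then the map $$\rho=\rho_K:\mathcal P^\Phi\to\mathcal M(K):(i,a)\mapsto2^i\,\overline a$$ (given on objects by $n\mapsto2^n$) is a faithful involutive tensor category representation. In particular, for each $n\in\mathbb N$ the map $\rho$ gives a faithful involutive representation of the monoid $\mathcal P_n^\Phi$ by $2^n\times2^n$ matrices over $K$.
   Context: **Partition category.** $\mathbb N=\{0,1,2,\ldots\}$, $[n]=\{1,\ldots,n\}$. For $A\subseteq\mathbb N$, $A'$ and $A''$ are disjoint copies of $A$. $\mathcal P_{m,n}$ is the set of all set partitions of $[m]\cup[n]'$; elements of $a$ are called $a$-blocks, and $a$ is identified with any graph whose connected components are its blocks. For $a\in\mathcal P_{m,n}$, $b\in\mathcal P_{n,t}$, the product graph $\Pi(a,b)$ has vertex set $[m]\cup[n]''\cup[t]'$ and edges those of $a$ (lower vertices $x'$ renamed $x''$) and of $b$ (upper vertices $x$ renamed $x''$). $ab\in\mathcal P_{m,t}$ is the partition in which $x,y\in[m]\cup[t]'$ are in the same block iff they are in the same component of $\Pi(a,b)$. $\Phi(a,b)$ is the number of connected components of $\Pi(a,b)$ contained in $[n]''$ (floating components). Identities are $\iota_n=\{\{i,i'\}:i\in[n]\}$; the involution $a\mapsto a^*$ swaps $i\leftrightarrow i'$; for $a\in\mathcal P_{m,n}$, $b\in\mathcal P_{s,t}$, $a\oplus b\in\mathcal P_{m+s,n+t}$ has as blocks all $a$-blocks and $(X+m)\cup(Y+n)'$ for each $b$-block $X\cup Y'$. **Twisted partition category.** $\mathcal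 P^\Phi$ has objects $\mathbb N$, hom-sets $\mathcal P^\Phi_{m,n}=\mathbb N\times\mathcal P_{m,n}$, composition $(i,a)(j,b)=(i+j+\Phi(a,b),ab)$, identities $(0,\iota_n)$, involution $(i,a)^*=(i,a^* )$, tensor operation $(i,a)\oplus(j,b)=(i+j,a\oplus b)$. $\mathcal P_n^\Phi=\mathcal P_{n,n}^\Phi$ is the twisted partition monoid. **Matrices.** A semiring $(K,+,\cdot,0,1)$ has $(K,+,0)$ a commutative monoid, $(K,\cdot,1)$ a monoid, distributivity, and $0$ a multiplicative zero; it has characteristic $0$ if $1$ generates an infinite subsemigroup under addition. A natural number $k$ is identified with $1+\cdots+1$ ($k$ terms) in $K$. $\mathcal M(K)$ has object set $\mathbb N$, hom-sets $\mathcal M_{m,n}(K)$ of $m\times n$ matrices over $K$, composition matrix multiplication, involution transpose, tensor operation the Kronecker product $\otimes$ (objects multiply). Matrices in $\mathcal M_{2^m,2^n}(K)$ are regarded as having rows/columns indexed by subsets of $[m]$, $[n]$; under this indexing the Kronecker product is $(A\otimes B)_{X\cup(U+m),\,Y\cup(V+n)}=A_{X,Y}B_{U,V}$ for $X\subseteq[m]$, $U\subseteq[s]$, $Y\subseteq[n]$, $V\subseteq[t]$ (for instance, using the bijections $X\mapsto1+\sum_{x\in X}2^{n-x}$ from subsets of $[n]$ to $[2^n]$ this is the usual Kronecker product). For $a\in\mathcal P_{m,n}$, $\overline a\in\mathcal M_{2^m,2^n}(K)$ is defined by $\overline a_{X,Y}=1$ if $X\cup Y'$ is a (possibly empty) union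 of $a$-blocks, and $0$ otherwise. **Representations.** A category representation is a functor; it is faithful if injective on objects and on morphisms, involutive if it preserves the involutions, and a tensor representation if it preserves the tensor operations. *)

theory Defs
  imports
    "HOL-Library.Disjoint_Sets"
    "HOL-Algebra.Group"
    "Jordan_Normal_Form.Matrix"
begin

section \<open>Categories, involutions, tensor operations, representations\<close>

text \<open>
  Morphisms of all hom-sets share one type, the hom-sets being pairwise disjoint, so that a
  functor acts by a single map on morphisms.  Composition is in diagrammatic order:
  \<open>Comp C f g\<close> is the product \<open>fg\<close> of \<open>f \<in> Hom C x y\<close> and \<open>g \<in> Hom C y z\<close>.
  The involution and the tensor operation are mere data, without axioms: over a
  noncommutative semiring the transpose does not reverse products, and the
  Kronecker product is not functorial.
\<close>

record ('o, 'm) tcat =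
  Obj :: "'o set"
  Hom :: "'o \<Rightarrow> 'o \<Rightarrow> 'm set"
  Id :: "'o \<Rightarrow> 'm"
  Comp :: "'m \<Rightarrow> 'm \<Rightarrow> 'm"
  Invol :: "'m \<Rightarrow> 'm"
  TensorObj :: "'o \<Rightarrow> 'o \<Rightarrow> 'o"
  Tensor :: "'m \<Rightarrow> 'm \<Rightarrow> 'm"

definition Mor :: "('o, 'm) tcat \<Rightarrow> 'm set" where
  "Mor C = (\<Union>x\<in>Obj C. \<Union>y\<in>Obj C. Hom C x y)"

locale category =
  fixes C :: "('o, 'm) tcat"
  assumes Hom_disjoint:
      "\<lbrakk>x \<in> Obj C; y \<in> Obj C; x' \<in> Obj C; y' \<in> Obj C; f \<in> Hom C x y; f \<in> Hom C x' y'\<rbrakk>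
        \<Longrightarrow> x = x' \<and> y = y'"
    and Id_closed: "x \<in> Obj C \<Longrightarrow> Id C x \<in> Hom C x x"
    and Comp_closed:
      "\<lbrakk>x \<in> Obj C; y \<in> Obj C; z \<in> Obj C; f \<in> Hom C x y; g \<in> Hom C y z\<rbrakk>
        \<Longrightarrow> Comp C f g \<in> Hom C x z"
    and Comp_assoc:
      "\<lbrakk>w \<in> Obj C; x \<in> Obj C; y \<in> Obj C; z \<in> Obj C;
        f \<in> Hom C w x; g \<in> Hom C x y; h \<in> Hom C y z\<rbrakk>
        \<Longrightarrow> Comp C (Comp C f g) h = Comp C f (Comp C g h)"
    and Id_left: "\<lbrakk>x \<in> Obj C; y \<in> Obj C; f \<in> Hom C x y\<rbrakk> \<Longrightarrow> Comp C (Id C x) f = f"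
    and Id_right: "\<lbrakk>x \<in> Obj C; y \<in> Obj C; f \<in> Hom C x y\<rbrakk> \<Longrightarrow> Comp C f (Id C y) = f"

locale category_representation = source: category C + target: category D
  for C :: "('o, 'm) tcat" and D :: "('p, 'n) tcat" +
  fixes F_obj :: "'o \<Rightarrow> 'p" and F :: "'m \<Rightarrow> 'n"
  assumes F_obj_closed: "x \<in> Obj C \<Longrightarrow> F_obj x \<in> Obj D"
    and F_closed:
      "\<lbrakk>x \<in> Obj C; y \<in> Obj C; f \<in> Hom C x y\<rbrakk> \<Longrightarrow> F f \<in> Hom D (F_obj x) (F_obj y)"
    and F_Id: "x \<in> Obj C \<Longrightarrow> F (Id C x) = Id D (F_obj x)"
    and F_Comp:
      "\<lbrakk>x \<in> Obj C; y \<in> Obj C; z \<in> Obj C; f \<in> Hom C x y; g \<in> Hom C y z\<rbrakk>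
        \<Longrightarrow> F (Comp C f g) = Comp D (F f) (F g)"

locale faithful_representation = category_representation +
  assumes inj_on_objects: "inj_on F_obj (Obj C)"
    and inj_on_morphisms: "inj_on F (Mor C)"

locale involutive_representation = category_representation +
  assumes F_Invol: "f \<in> Mor C \<Longrightarrow> F (Invol C f) = Invol D (F f)"

locale tensor_representation = category_representation +
  assumes F_TensorObj:
      "\<lbrakk>x \<in> Obj C; y \<in> Obj C\<rbrakk> \<Longrightarrow> F_obj (TensorObj C x y) = TensorObj D (F_obj x) (F_obj y)"
    and F_Tensor:
      "\<lbrakk>f \<in> Mor C; g \<in> Mor C\<rbrakk> \<Longrightarrow> F (Tensor C f g) = Tensor D (F f) (F g)"

definition End_monoid :: "('o, 'm) tcat \<Rightarrow> 'o \<Rightarrow> 'm monoid" where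
  "End_monoid C x = \<lparr>carrier = Hom C x x, monoid.mult = Comp C, one = Id C x\<rparr>"


section \<open>The twisted partition category\<close>

text \<open>\<open>Upper x\<close>, \<open>Lower x\<close>, \<open>Middle x\<close> stand for \<open>x\<close>, \<open>x'\<close>, \<open>x''\<close>.\<close>

datatype vertex = Upper nat | Lower nat | Middle nat

definition partitions :: "nat \<Rightarrow> nat \<Rightarrow> vertex set set set" where
  "partitions m n = {a. partition_on (Upper ` {1..m} \<union> Lower ` {1..n}) a}"

text \<open>A partition in \<open>partitions m n\<close> determines \<open>m\<close> and \<open>n\<close>.\<close>

definition upper_size :: "vertex set set \<Rightarrow> nat" where
  "upper_size a = card {x. Upper x \<in> \<Union>a}"

definition lower_size :: "vertex set set \<Rightarrow> nat" where
  "lower_size a = card {x. Lower x \<in> \<Union>a}"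

fun lower_to_middle :: "vertex \<Rightarrow> vertex" where
  "lower_to_middle (Lower x) = Middle x"
| "lower_to_middle v = v"

fun upper_to_middle :: "vertex \<Rightarrow> vertex" where
  "upper_to_middle (Upper x) = Middle x"
| "upper_to_middle v = v"

text \<open>
  The product graph of \<open>a \<in> partitions m n\<close> and \<open>b \<in> partitions n t\<close>, given by its vertex set
  and its (symmetric) adjacency relation; a partition is represented by the graph in which
  any two elements of the same block are adjacent.
\<close>

definition prod_vertices :: "vertex set set \<Rightarrow> vertex set set \<Rightarrow> vertex set" where
  "prod_vertices a b = lower_to_middle ` \<Union>a \<union> upper_to_middle ` \<Union>b"

definition prod_edges :: "vertex set set \<Rightarrow> vertex set set \<Rightarrow> (vertex \<times> vertex) set" where
  "prod_edges a b =
     (\<Union>B\<in>a. (lower_to_middle ` B) \<times> (lower_to_middle ` B)) \<union>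
     (\<Union>B\<in>b. (upper_to_middle ` B) \<times> (upper_to_middle ` B))"

definition prod_components :: "vertex set set \<Rightarrow> vertex set set \<Rightarrow> vertex set set" where
  "prod_components a b = prod_vertices a b // (prod_edges a b)\<^sup>*"

definition part_mult :: "vertex set set \<Rightarrow> vertex set set \<Rightarrow> vertex set set" where
  "part_mult a b =
     (let V = prod_vertices a b - range Middle
      in V // {(x, y) \<in> V \<times> V. \<exists>C\<in>prod_components a b. x \<in> C \<and> y \<in> C})"

definition floating :: "vertex set set \<Rightarrow> vertex set set \<Rightarrow> nat" where
  "floating a b = card {C \<in> prod_components a b. C \<subseteq> range Middle}"

definition part_id :: "nat \<Rightarrow> vertex set set" where
  "part_id n = {{Upper i, Lower i} | i. i \<in> {1..n}}"

fun flip :: "vertex \<Rightarrow> vertex" where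
  "flip (Upper x) = Lower x"
| "flip (Lower x) = Upper x"
| "flip (Middle x) = Middle x"

definition part_star :: "vertex set set \<Rightarrow> vertex set set" where
  "part_star a = (`) flip ` a"

fun shift :: "nat \<Rightarrow> nat \<Rightarrow> vertex \<Rightarrow> vertex" where
  "shift m n (Upper x) = Upper (x + m)"
| "shift m n (Lower x) = Lower (x + n)"
| "shift m n (Middle x) = Middle x"

definition part_oplus :: "vertex set set \<Rightarrow> vertex set set \<Rightarrow> vertex set set" where
  "part_oplus a b = a \<union> (`) (shift (upper_size a) (lower_size a)) ` b"

definition twisted_partition_category :: "(nat, nat \<times> vertex set set) tcat" where
  "twisted_partition_category =
     \<lparr>Obj = UNIV,
      Hom = (\<lambda>m n. UNIV \<times> partitions m n),
      Id = (\<lambda>n. (0, part_id n)),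
      Comp = (\<lambda>(i, a) (j, b). (i + j + floating a b, part_mult a b)),
      Invol = (\<lambda>(i, a). (i, part_star a)),
      TensorObj = (+),
      Tensor = (\<lambda>(i, a) (j, b). (i + j, part_oplus a b))\<rparr>"


section \<open>The matrix category\<close>

definition kronecker :: "'k::semiring_1 mat \<Rightarrow> 'k mat \<Rightarrow> 'k mat" where
  "kronecker A B =
     mat (dim_row A * dim_row B) (dim_col A * dim_col B)
       (\<lambda>(i, j). A $$ (i div dim_row B, j div dim_col B) * B $$ (i mod dim_row B, j mod dim_col B))"

definition matrix_category :: "(nat, 'k::semiring_1 mat) tcat" where
  "matrix_category =
     \<lparr>Obj = UNIV,
      Hom = carrier_mat,
      Id = 1\<^sub>m,
      Comp = (*),
      Invol = transpose_mat,
      TensorObj = (*),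
      Tensor = kronecker\<rparr>"

text \<open>
  Rows and columns are indexed by subsets through \<open>X \<mapsto> 1 + \<Sum>x\<in>X. 2^(n-x)\<close>; the summand \<open>1\<close>
  disappears because matrix indices start from \<open>0\<close> here.
\<close>

definition subset_index :: "nat \<Rightarrow> nat set \<Rightarrow> nat" where
  "subset_index n X = (\<Sum>x\<in>X. 2 ^ (n - x))"

definition index_subset :: "nat \<Rightarrow> nat \<Rightarrow> nat set" where
  "index_subset n = the_inv_into (Pow {1..n}) (subset_index n)"

definition part_matrix :: "vertex set set \<Rightarrow> 'k::semiring_1 mat" where
  "part_matrix a =
     (let m = upper_size a; n = lower_size a in
      mat (2 ^ m) (2 ^ n)
        (\<lambda>(i, j). if \<exists>S\<subseteq>a. Upper ` index_subset m i \<union> Lower ` index_subset n j = \<Union>S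
                  then 1 else 0))"

definition rho :: "nat \<times> vertex set set \<Rightarrow> 'k::semiring_1 mat" where
  "rho = (\<lambda>(i, a). 2 ^ i \<cdot>\<^sub>m part_matrix a)"

definition rho_obj :: "nat \<Rightarrow> nat" where
  "rho_obj n = 2 ^ n"

text \<open>
  Characteristic \<open>0\<close> in the sense of semirings: the multiples \<open>1, 1 + 1, \<dots>\<close> form an infinite set.
  This is stronger than \<open>CHAR('k) = 0\<close>, which also holds for the Boolean semiring.
  It implies \<open>0 \<noteq> 1\<close>, so working in class \<open>semiring_1\<close> loses nothing.
\<close>

definition semiring_characteristic_0 :: "'k::semiring_1 itself \<Rightarrow> bool" where
  "semiring_characteristic_0 _ \<longleftrightarrow> infinite {of_nat k :: 'k | k. k \<ge> 1}"

end

theory Submission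
  imports Defs "HOL-Library.Nat_Bijection"
begin

text \<open>
  Write \<open>B(X, Y)\<close> for the condition that \<open>X \<union> Y'\<close> is a union of blocks of a partition.
  Multiplicativity is a count.  The entry of the product of the matrices of \<open>a\<close> and \<open>b\<close> at
  \<open>(X, Z)\<close> is the number of subsets \<open>Y\<close> of the middle row such that \<open>B(X, Y)\<close> holds for \<open>a\<close> and
  \<open>B(Y, Z)\<close> holds for \<open>b\<close>.  Both conditions together say that \<open>X \<union> Y'' \<union> Z'\<close> is closed under
  adjacency in the product graph, that is, a union of its components
  (\<open>block_union_prod_components_iff\<close>).  The blocks of \<open>ab\<close> are the nonempty traces of the
  components on the two outer rows (\<open>part_mult_eq\<close>), so such a \<open>Y\<close> exists only if \<open>X \<union> Z'\<close> is a
  union of blocks of \<open>ab\<close>.  In that case the components that meet the outer rows are included or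
  excluded as \<open>X\<close> and \<open>Z\<close> dictate, while each floating component may be included or not, which
  gives \<open>2 ^ floating a b\<close> choices (\<open>card_block_union_extensions\<close>, \<open>card_intermediate_subsets\<close>).
  The twist in the composition contributes exactly this factor, hence \<open>rho_mult\<close>.

  Faithfulness (\<open>rho_eq_imp_eq\<close>): every matrix \<open>rho (i, a)\<close> has the entry \<open>2 ^ i\<close> at
  \<open>({}, {})\<close>, because the empty set is a union of blocks.  In characteristic \<open>0\<close> this determines \<open>i\<close>,
  and \<open>2 ^ i\<close> is nonzero, so the positions of the nonzero entries determine which sets are unions
  of blocks.  The blocks are the minimal nonempty ones among these.

  Identities, the involution and the tensor operation are compared entry by entry; for the latter,
  the index of \<open>X \<union> (U + m)\<close> is the two-digit expression that the Kronecker product uses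
  (\<open>subset_index_append\<close>).

  That the twisted partition category is a category at all needs associativity of the product and
  the cocycle identity for \<open>floating\<close>.  Neither is verified on graphs: both sides have the same
  image under the injective map \<open>rho\<close> into matrices over the natural numbers, where multiplication
  is associative (\<open>category_if_faithful_image\<close>).
\<close>

section \<open>Unions of blocks\<close>

definition block_union :: "'a set set \<Rightarrow> 'a set \<Rightarrow> bool" where
  "block_union P T \<longleftrightarrow> (\<exists>S\<subseteq>P. T = \<Union>S)"

lemma block_union_subset: "block_union P T \<Longrightarrow> T \<subseteq> \<Union>P"
  by (auto simp: block_union_def)

lemma block_union_empty [simp]: "block_union P {}"
  unfolding block_union_def by (rule exI[of _ "{}"]) auto

lemma block_union_iff_saturated:
  assumes "partition_on W P"
  shows "block_union P T \<longleftrightarrow> T \<subseteq> W \<and> (\<forall>B\<in>P. B \<inter> T \<noteq> {} \<longrightarrow> B \<subseteq> T)"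
proof
  assume "block_union P T"
  then obtain S where S: "S \<subseteq> P" "T = \<Union>S" unfolding block_union_def by blast
  have "B \<subseteq> T" if "B \<in> P" "B \<inter> T \<noteq> {}" for B
  proof -
    from that S obtain C where "C \<in> S" "B \<inter> C \<noteq> {}" by auto
    with S that have "B = C" using assms by (auto simp: partition_on_def disjoint_def)
    with S \<open>C \<in> S\<close> show ?thesis by auto
  qed
  moreover have "T \<subseteq> W" using S assms by (auto simp: partition_on_def)
  ultimately show "T \<subseteq> W \<and> (\<forall>B\<in>P. B \<inter> T \<noteq> {} \<longrightarrow> B \<subseteq> T)" by blast
next
  assume T: "T \<subseteq> W \<and> (\<forall>B\<in>P. B \<inter> T \<noteq> {} \<longrightarrow> B \<subseteq> T)"
  moreover have "W = \<Union>P" using assms by (auto simp: partition_on_def)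
  ultimately have "T = \<Union>{B \<in> P. B \<inter> T \<noteq> {}}" by blast
  then show "block_union P T" unfolding block_union_def
    by (intro exI[of _ "{B \<in> P. B \<inter> T \<noteq> {}}"] conjI) auto
qed

text \<open>
  Allows the membership test to be performed on a renamed copy \<open>g x\<close> of each point, inside a larger
  set \<open>T'\<close> that may contain other points too: this is how a partition sits inside a product graph.
\<close>

lemma block_union_iff_closed_under_map:
  assumes P: "partition_on W P" and T: "T \<subseteq> W"
    and g: "\<And>x. x \<in> W \<Longrightarrow> g x \<in> T' \<longleftrightarrow> x \<in> T"
  shows "block_union P T \<longleftrightarrow> (\<forall>B\<in>P. \<forall>x\<in>B. \<forall>y\<in>B. g x \<in> T' \<longrightarrow> g y \<in> T')"
proof -
  have "g x \<in> T' \<longleftrightarrow> x \<in> T" if "B \<in> P" "x \<in> B" for B x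
    using g that partition_onD1[OF P] by blast
  then have "(\<forall>B\<in>P. \<forall>x\<in>B. \<forall>y\<in>B. g x \<in> T' \<longrightarrow> g y \<in> T') \<longleftrightarrow>
      (\<forall>B\<in>P. \<forall>x\<in>B. \<forall>y\<in>B. x \<in> T \<longrightarrow> y \<in> T)"
    by (intro ball_cong refl) simp
  also have "\<dots> \<longleftrightarrow> (\<forall>B\<in>P. B \<inter> T \<noteq> {} \<longrightarrow> B \<subseteq> T)" by blast
  finally show ?thesis using T by (simp add: block_union_iff_saturated[OF P])
qed

lemma block_union_image:
  assumes "inj_on f W" "\<Union>P \<subseteq> W" "T \<subseteq> W"
  shows "block_union ((`) f ` P) (f ` T) \<longleftrightarrow> block_union P T"
proof
  assume "block_union ((`) f ` P) (f ` T)"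
  then obtain S where "S \<subseteq> P" "f ` T = \<Union>((`) f ` S)"
    unfolding block_union_def by (metis subset_imageE)
  moreover from this have "f ` T = f ` \<Union>S" by (simp add: image_Union)
  moreover from \<open>S \<subseteq> P\<close> have "\<Union>S \<subseteq> W" using assms(2) by blast
  ultimately have "T = \<Union>S" using assms(1,3) by (metis inj_on_image_eq_iff)
  with \<open>S \<subseteq> P\<close> show "block_union P T" by (auto simp: block_union_def)
next
  assume "block_union P T"
  then obtain S where "S \<subseteq> P" "T = \<Union>S" unfolding block_union_def by blast
  then have "(`) f ` S \<subseteq> (`) f ` P" "f ` T = \<Union>((`) f ` S)" by auto
  then show "block_union ((`) f ` P) (f ` T)" unfolding block_union_def by blast
qed

lemma block_union_Un:
  assumes "\<Union>P \<subseteq> V" "\<Union>Q \<subseteq> W" "V \<inter> W = {}" "T \<subseteq> V" "U \<subseteq> W"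
  shows "block_union (P \<union> Q) (T \<union> U) \<longleftrightarrow> block_union P T \<and> block_union Q U"
proof
  assume "block_union (P \<union> Q) (T \<union> U)"
  then obtain S where S: "S \<subseteq> P \<union> Q" "T \<union> U = \<Union>S" unfolding block_union_def by blast
  have "S = (S \<inter> P) \<union> (S \<inter> Q)" using S by blast
  then have "T \<union> U = \<Union>(S \<inter> P) \<union> \<Union>(S \<inter> Q)" using S(2) by (metis Union_Un_distrib)
  moreover have "\<Union>(S \<inter> P) \<subseteq> V" "\<Union>(S \<inter> Q) \<subseteq> W" using assms by auto
  ultimately have "T = \<Union>(S \<inter> P)" "U = \<Union>(S \<inter> Q)" using assms(3-5) by blast+
  then show "block_union P T \<and> block_union Q U" unfolding block_union_def by blast
next
  assume "block_union P T \<and> block_union Q U"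
  then obtain S R where "S \<subseteq> P" "T = \<Union>S" "R \<subseteq> Q" "U = \<Union>R"
    unfolding block_union_def by blast
  then have "S \<union> R \<subseteq> P \<union> Q" "T \<union> U = \<Union>(S \<union> R)" by auto
  then show "block_union (P \<union> Q) (T \<union> U)" unfolding block_union_def by blast
qed

text \<open>
  A block of \<open>P\<close> is a union of blocks of \<open>Q\<close>; if it contained a block of \<open>Q\<close> properly, this smaller
  set would again be a union of blocks of \<open>P\<close>, which is impossible.
\<close>

lemma partition_subset_if_block_unions:
  assumes P: "partition_on W P" and Q: "partition_on W Q"
    and eq: "\<And>T. T \<subseteq> W \<Longrightarrow> block_union P T \<longleftrightarrow> block_union Q T"
  shows "P \<subseteq> Q"
proof
  fix B assume B: "B \<in> P"
  then obtain x where x: "x \<in> B" using P by (metis all_not_in_conv partition_onD3)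
  have BW: "B \<subseteq> W" using B P by (auto simp: partition_on_def)
  have "block_union P B" unfolding block_union_def using B by (intro exI[of _ "{B}"]) auto
  then have "block_union Q B" using eq BW by blast
  then obtain C where C: "C \<in> Q" "x \<in> C" "C \<subseteq> B"
    using x unfolding block_union_def by blast
  then have "block_union Q C" unfolding block_union_def by (intro exI[of _ "{C}"]) auto
  then have "block_union P C" using eq C BW by blast
  then have "B \<subseteq> C" using block_union_iff_saturated[OF P] B x C by blast
  with C show "B \<in> Q" by auto
qed

lemma partition_eq_if_block_unions:
  assumes "partition_on W P" "partition_on W Q"
    and "\<And>T. T \<subseteq> W \<Longrightarrow> block_union P T \<longleftrightarrow> block_union Q T"
  shows "P = Q"
proof
  show "P \<subseteq> Q" by (rule partition_subset_if_block_unions[OF assms])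
  show "Q \<subseteq> P" by (rule partition_subset_if_block_unions[OF assms(2,1)]) (simp add: assms(3))
qed

lemma partition_on_Un_disjoint:
  assumes P: "partition_on A P" and Q: "partition_on B Q" and "A \<inter> B = {}"
  shows "partition_on (A \<union> B) (P \<union> Q)"
proof (rule partition_onI)
  have A: "\<Union>P = A" and B: "\<Union>Q = B" using P Q by (simp_all add: partition_on_def)
  then show "\<Union>(P \<union> Q) = A \<union> B" by simp
  show "{} \<notin> P \<union> Q" using P Q by (simp add: partition_on_def)
  have PQ: "disjnt p q" if "p \<in> P" "q \<in> Q" for p q
  proof -
    have "p \<subseteq> A" "q \<subseteq> B" using that A B by auto
    then show ?thesis using assms(3) by (auto simp: disjnt_def)
  qed
  fix p q assume "p \<in> P \<union> Q" "q \<in> P \<union> Q" "p \<noteq> q"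
  then show "disjnt p q"
    using PQ disjnt_sym P Q by (auto simp: partition_on_def pairwise_def)
qed

text \<open>
  The source of the powers of \<open>2\<close>.  If \<open>U\<close> is a union of traces \<open>C - M\<close>, then the blocks that
  meet \<open>U\<close> are forced into \<open>U \<union> Y\<close>, the other blocks not contained in \<open>M\<close> are forbidden, and the
  blocks inside \<open>M\<close> can be chosen freely.
\<close>

lemma card_block_union_extensions:
  assumes P: "partition_on W P" and fin: "finite P" and disj: "U \<inter> M = {}"
  shows "card {Y. Y \<subseteq> M \<and> block_union P (U \<union> Y)} =
    (if block_union ((\<lambda>C. C - M) ` P - {{}}) U then 2 ^ card {C \<in> P. C \<subseteq> M} else 0)"
proof (cases "block_union ((\<lambda>C. C - M) ` P - {{}}) U")
  case False
  have "\<not> block_union P (U \<union> Y)" if "Y \<subseteq> M" for Y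
  proof
    assume "block_union P (U \<union> Y)"
    then obtain S where S: "S \<subseteq> P" "U \<union> Y = \<Union>S" unfolding block_union_def by blast
    then have "U = \<Union>S - M" using disj that by auto
    then have "U = \<Union>((\<lambda>C. C - M) ` S - {{}})" by auto
    moreover have "(\<lambda>C. C - M) ` S - {{}} \<subseteq> (\<lambda>C. C - M) ` P - {{}}" using S by auto
    ultimately show False using False unfolding block_union_def by blast
  qed
  then have none: "{Y. Y \<subseteq> M \<and> block_union P (U \<union> Y)} = {}" by auto
  show ?thesis unfolding none using False by simp
next
  case True
  have same: "C = D" if "C \<in> P" "D \<in> P" "x \<in> C" "x \<in> D" for C D x
    using P that by (auto simp: partition_on_def disjoint_def)
  \<comment> \<open>the free blocks and the forced blocks\<close>
  define F where "F = {C \<in> P. C \<subseteq> M}"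
  define N where "N = {C \<in> P. C \<inter> U \<noteq> {}}"
  have UP: "\<exists>C\<in>P. x \<in> C \<and> C - M \<subseteq> U" if "x \<in> U" for x
    using True that unfolding block_union_def by blast
  \<comment> \<open>Outside \<open>M\<close> the forced blocks add nothing to \<open>U\<close>, so forcing them is consistent.\<close>
  have NU: "\<Union>N - M = U"
  proof
    show "\<Union>N - M \<subseteq> U"
    proof
      fix x assume "x \<in> \<Union>N - M"
      then obtain C y where C: "C \<in> P" "x \<in> C" "x \<notin> M" "y \<in> C" "y \<in> U"
        unfolding N_def by blast
      with UP obtain D where "D \<in> P" "y \<in> D" "D - M \<subseteq> U" by blast
      with C same show "x \<in> U" by blast
    qed
    show "U \<subseteq> \<Union>N - M" using UP disj unfolding N_def by blast
  qed
  have FN: "x \<notin> \<Union>N" if "C \<in> F" "x \<in> C" for C x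
    using that same disj unfolding F_def N_def by blast
  let ?ext = "\<lambda>S. (\<Union>N \<inter> M) \<union> \<Union>S"
  let ?flt = "\<lambda>Y. {C \<in> F. C \<subseteq> Y}"
  have "bij_betw ?ext (Pow F) {Y. Y \<subseteq> M \<and> block_union P (U \<union> Y)}"
  proof (rule bij_betw_byWitness[where f' = ?flt])
    show "\<forall>S\<in>Pow F. ?flt (?ext S) = S"
    proof
      fix S assume S: "S \<in> Pow F"
      have "C \<in> S" if CF: "C \<in> F" "C \<subseteq> ?ext S" for C
      proof -
        have "C \<noteq> {}" using that partition_onD3[OF P] by (auto simp: F_def)
        then obtain x where x: "x \<in> C" by blast
        then have "x \<in> ?ext S" using CF by blast
        moreover have "x \<notin> \<Union>N" using FN x CF by blast
        ultimately obtain D where "D \<in> S" "x \<in> D" by blast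
        then show ?thesis using same[of C D x] x that S by (auto simp: F_def)
      qed
      then show "?flt (?ext S) = S" using S by blast
    qed
    show "\<forall>Y\<in>{Y. Y \<subseteq> M \<and> block_union P (U \<union> Y)}. ?ext (?flt Y) = Y"
    proof
      fix Y assume "Y \<in> {Y. Y \<subseteq> M \<and> block_union P (U \<union> Y)}"
      then have Y: "Y \<subseteq> M" and bu: "block_union P (U \<union> Y)" by simp_all
      have sat: "C \<subseteq> U \<union> Y" if "C \<in> P" "C \<inter> (U \<union> Y) \<noteq> {}" for C
        using bu that unfolding block_union_iff_saturated[OF P] by simp
      have YP: "Y \<subseteq> \<Union>P" using block_union_subset[OF bu] by simp
      show "?ext (?flt Y) = Y"
      proof
        have "x \<in> Y" if "C \<in> N" "x \<in> C" "x \<in> M" for C x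
        proof -
          have "C \<inter> (U \<union> Y) \<noteq> {}" "C \<in> P" using that by (auto simp: N_def)
          then have "x \<in> U \<union> Y" using sat that by blast
          then show ?thesis using disj that by blast
        qed
        then show "?ext (?flt Y) \<subseteq> Y" by blast
        show "Y \<subseteq> ?ext (?flt Y)"
        proof
          fix x assume x: "x \<in> Y"
          then obtain C where C: "C \<in> P" "x \<in> C" using YP by blast
          then have CU: "C \<subseteq> U \<union> Y" using sat x by blast
          show "x \<in> ?ext (?flt Y)"
          proof (cases "C \<subseteq> M")
            case True
            then have "C \<in> F" "C \<subseteq> Y" using C CU disj by (auto simp: F_def)
            then show ?thesis using C by blast
          next
            case False
            then have "C \<inter> U \<noteq> {}" using CU Y by blast
            then have "C \<in> N" using C by (simp add: N_def)
            then show ?thesis using C(2) x Y by (intro UnI1 IntI UnionI) auto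
          qed
        qed
      qed
    qed
    show "?ext ` Pow F \<subseteq> {Y. Y \<subseteq> M \<and> block_union P (U \<union> Y)}"
    proof (rule image_subsetI)
      fix S assume "S \<in> Pow F"
      then have S: "S \<subseteq> F" by simp
      have "\<Union>(N \<union> S) = (\<Union>N - M) \<union> ?ext S" by blast
      then have "U \<union> ?ext S = \<Union>(N \<union> S)" by (simp only: NU)
      moreover have "N \<union> S \<subseteq> P" using S by (auto simp: N_def F_def)
      ultimately have "block_union P (U \<union> ?ext S)" unfolding block_union_def by blast
      moreover have "?ext S \<subseteq> M" using S by (auto simp: F_def)
      ultimately show "?ext S \<in> {Y. Y \<subseteq> M \<and> block_union P (U \<union> Y)}" by simp
    qed
    show "?flt ` {Y. Y \<subseteq> M \<and> block_union P (U \<union> Y)} \<subseteq> Pow F" by auto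
  qed
  then have "card {Y. Y \<subseteq> M \<and> block_union P (U \<union> Y)} = card (Pow F)"
    using bij_betw_same_card by fastforce
  also have "\<dots> = 2 ^ card F" using fin by (simp add: card_Pow F_def)
  finally show ?thesis using True by (simp add: F_def)
qed

section \<open>Connected components\<close>

lemma Image_rtrancl_subset:
  assumes "E \<subseteq> V \<times> V" "x \<in> V"
  shows "E\<^sup>* `` {x} \<subseteq> V"
proof -
  have "y \<in> V" if "(x, y) \<in> E\<^sup>*" for y
    using that assms by (induction rule: rtrancl_induct) auto
  then show ?thesis by auto
qed

lemma partition_on_components:
  assumes E: "E \<subseteq> V \<times> V" "sym E"
  shows "partition_on V (V // E\<^sup>*)"
proof (rule partition_onI)
  show "\<Union>(V // E\<^sup>*) = V"
    using Image_rtrancl_subset[OF E(1)] by (auto simp: quotient_def)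
  show "{} \<notin> V // E\<^sup>*"
    by (auto simp: quotient_def)
  have eqv: "equiv UNIV (E\<^sup>*)"
    using E(2) by (auto intro!: equivI refl_rtrancl trans_rtrancl sym_rtrancl)
  fix p q assume "p \<in> V // E\<^sup>*" "q \<in> V // E\<^sup>*" "p \<noteq> q"
  then show "disjnt p q"
    using quotient_disj[OF eqv, of p q] by (auto simp: quotient_def disjnt_def)
qed

lemma block_union_components_iff:
  assumes E: "E \<subseteq> V \<times> V" "sym E"
  shows "block_union (V // E\<^sup>*) T \<longleftrightarrow> T \<subseteq> V \<and> (\<forall>(x, y)\<in>E. x \<in> T \<longrightarrow> y \<in> T)"
proof -
  have "(\<forall>C\<in>V // E\<^sup>*. C \<inter> T \<noteq> {} \<longrightarrow> C \<subseteq> T) \<longleftrightarrow> (\<forall>(x, y)\<in>E. x \<in> T \<longrightarrow> y \<in> T)"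
  proof
    assume *: "\<forall>C\<in>V // E\<^sup>*. C \<inter> T \<noteq> {} \<longrightarrow> C \<subseteq> T"
    show "\<forall>(x, y)\<in>E. x \<in> T \<longrightarrow> y \<in> T"
    proof clarify
      fix x y assume xy: "(x, y) \<in> E" "x \<in> T"
      then have "E\<^sup>* `` {x} \<in> V // E\<^sup>*" using E by (auto intro: quotientI)
      then have "E\<^sup>* `` {x} \<subseteq> T" using * xy by blast
      then show "y \<in> T" using xy by blast
    qed
  next
    assume *: "\<forall>(x, y)\<in>E. x \<in> T \<longrightarrow> y \<in> T"
    have step: "y \<in> T" if "(x, y) \<in> E\<^sup>*" "x \<in> T" for x y
      using that * by (induction rule: rtrancl_induct) auto
    show "\<forall>C\<in>V // E\<^sup>*. C \<inter> T \<noteq> {} \<longrightarrow> C \<subseteq> T"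
    proof (intro ballI impI)
      fix C assume C: "C \<in> V // E\<^sup>*" "C \<inter> T \<noteq> {}"
      then obtain x y where x: "C = E\<^sup>* `` {x}" "(x, y) \<in> E\<^sup>*" "y \<in> T"
        by (auto simp: quotient_def)
      then have "(y, x) \<in> E\<^sup>*" using E(2) by (meson symD sym_rtrancl)
      then show "C \<subseteq> T" using x step by blast
    qed
  qed
  then show ?thesis using block_union_iff_saturated[OF partition_on_components[OF E]] by blast
qed

section \<open>The product of partitions\<close>

lemma Union_partitions:
  "a \<in> partitions m n \<Longrightarrow> \<Union>a = Upper ` {1..m} \<union> Lower ` {1..n}"
  by (simp add: partitions_def partition_on_def)

lemma upper_size_eq [simp]: "a \<in> partitions m n \<Longrightarrow> upper_size a = m"
proof -
  assume "a \<in> partitions m n"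
  then have "\<Union>a = Upper ` {1..m} \<union> Lower ` {1..n}" by (rule Union_partitions)
  then have "{x. Upper x \<in> \<Union>a} = {1..m}" by (simp only:) auto
  then show ?thesis by (simp add: upper_size_def)
qed

lemma lower_size_eq [simp]: "a \<in> partitions m n \<Longrightarrow> lower_size a = n"
proof -
  assume "a \<in> partitions m n"
  then have "\<Union>a = Upper ` {1..m} \<union> Lower ` {1..n}" by (rule Union_partitions)
  then have "{x. Lower x \<in> \<Union>a} = {1..n}" by (simp only:) auto
  then show ?thesis by (simp add: lower_size_def)
qed

lemma prod_vertices_eq:
  assumes "a \<in> partitions m n" "b \<in> partitions n t"
  shows "prod_vertices a b = Upper ` {1..m} \<union> Middle ` {1..n} \<union> Lower ` {1..t}"
  unfolding prod_vertices_def Union_partitions[OF assms(1)] Union_partitions[OF assms(2)]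
  by (simp add: image_Un image_image Un_ac)

lemma prod_edges_subset: "prod_edges a b \<subseteq> prod_vertices a b \<times> prod_vertices a b"
  unfolding prod_edges_def prod_vertices_def by blast

lemma sym_prod_edges: "sym (prod_edges a b)"
  unfolding prod_edges_def sym_def by blast

lemma prod_edges_closed_iff:
  "(\<forall>(x, y)\<in>prod_edges a b. x \<in> T \<longrightarrow> y \<in> T) \<longleftrightarrow>
    (\<forall>B\<in>a. \<forall>x\<in>B. \<forall>y\<in>B. lower_to_middle x \<in> T \<longrightarrow> lower_to_middle y \<in> T) \<and>
    (\<forall>B\<in>b. \<forall>x\<in>B. \<forall>y\<in>B. upper_to_middle x \<in> T \<longrightarrow> upper_to_middle y \<in> T)"
  unfolding prod_edges_def ball_Un ball_UN by auto

lemma partition_on_prod_components: "partition_on (prod_vertices a b) (prod_components a b)"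
  unfolding prod_components_def
  by (rule partition_on_components[OF prod_edges_subset sym_prod_edges])

lemma finite_prod_components:
  assumes "a \<in> partitions m n" "b \<in> partitions n t"
  shows "finite (prod_components a b)"
  using finite_elements[OF _ partition_on_prod_components[of a b]]
  by (simp add: prod_vertices_eq[OF assms])

lemma partition_on_prod_nonmiddle:
  "partition_on (prod_vertices a b - range Middle)
     ((\<lambda>C. C - range Middle) ` prod_components a b - {{}})"
proof -
  have "(\<inter>) (- range Middle) = (\<lambda>C. C - range Middle)" by auto
  then show ?thesis
    using partition_on_restrict[OF partition_on_prod_components, of "- range Middle" a b] by simp
qed

text \<open>
  Removing the middle row from the components leaves a partition of the outer rows, and the
  relation in the definition of \<open>part_mult\<close> is the equivalence relation belonging to it.  The set
  \<open>{}\<close> that is removed is the trace of the floating components.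
\<close>

lemma part_mult_eq:
  "part_mult a b = (\<lambda>C. C - range Middle) ` prod_components a b - {{}}"
proof -
  let ?V = "prod_vertices a b - range Middle"
  let ?Q = "(\<lambda>C. C - range Middle) ` prod_components a b - {{}}"
  note Q = partition_on_prod_nonmiddle[of a b]
  have "{(x, y) \<in> ?V \<times> ?V. \<exists>C\<in>prod_components a b. x \<in> C \<and> y \<in> C} =
      {(x, y). \<exists>C\<in>?Q. x \<in> C \<and> y \<in> C}"
    using partition_onD1[OF Q] by blast
  then show ?thesis
    unfolding part_mult_def Let_def using partition_on_eq_quotient[OF Q] by simp
qed

lemma part_mult_closed:
  assumes "a \<in> partitions m n" "b \<in> partitions n t"
  shows "part_mult a b \<in> partitions m t"
proof -
  have "prod_vertices a b - range Middle = Upper ` {1..m} \<union> Lower ` {1..t}"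
    by (auto simp: prod_vertices_eq[OF assms])
  then show ?thesis
    using partition_on_prod_nonmiddle[of a b] by (simp add: part_mult_eq partitions_def)
qed

text \<open>
  A set of vertices is a union of components iff it is closed under adjacency, and an edge of the
  product graph comes from a block of \<open>a\<close> or from a block of \<open>b\<close>.  So the condition splits into one
  on \<open>a\<close>, which sees the upper and middle rows only, and one on \<open>b\<close>, which sees the middle and lower
  rows only.
\<close>

lemma block_union_prod_components_iff:
  assumes a: "a \<in> partitions m n" and b: "b \<in> partitions n t"
    and X: "X \<subseteq> {1..m}" and Y: "Y \<subseteq> {1..n}" and Z: "Z \<subseteq> {1..t}"
  shows "block_union (prod_components a b) ((Upper ` X \<union> Lower ` Z) \<union> Middle ` Y) \<longleftrightarrow>
    block_union a (Upper ` X \<union> Lower ` Y) \<and> block_union b (Upper ` Y \<union> Lower ` Z)"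
proof -
  let ?T = "(Upper ` X \<union> Lower ` Z) \<union> Middle ` Y"
  have pa: "partition_on (Upper ` {1..m} \<union> Lower ` {1..n}) a"
    and pb: "partition_on (Upper ` {1..n} \<union> Lower ` {1..t}) b"
    using a b by (simp_all add: partitions_def)
  have TV: "?T \<subseteq> prod_vertices a b" using X Y Z by (auto simp: prod_vertices_eq[OF a b])
  have "block_union (prod_components a b) ?T \<longleftrightarrow> (\<forall>(x, y)\<in>prod_edges a b. x \<in> ?T \<longrightarrow> y \<in> ?T)"
    unfolding prod_components_def
    by (simp only: block_union_components_iff[OF prod_edges_subset sym_prod_edges] TV simp_thms)
  also have "\<dots> \<longleftrightarrow>
      (\<forall>B\<in>a. \<forall>x\<in>B. \<forall>y\<in>B. lower_to_middle x \<in> ?T \<longrightarrow> lower_to_middle y \<in> ?T) \<and>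
      (\<forall>B\<in>b. \<forall>x\<in>B. \<forall>y\<in>B. upper_to_middle x \<in> ?T \<longrightarrow> upper_to_middle y \<in> ?T)"
    by (rule prod_edges_closed_iff)
  also have "(\<forall>B\<in>a. \<forall>x\<in>B. \<forall>y\<in>B. lower_to_middle x \<in> ?T \<longrightarrow> lower_to_middle y \<in> ?T) \<longleftrightarrow>
      block_union a (Upper ` X \<union> Lower ` Y)"
    by (rule block_union_iff_closed_under_map[OF pa, symmetric]) (use X Y in auto)
  also have "(\<forall>B\<in>b. \<forall>x\<in>B. \<forall>y\<in>B. upper_to_middle x \<in> ?T \<longrightarrow> upper_to_middle y \<in> ?T) \<longleftrightarrow>
      block_union b (Upper ` Y \<union> Lower ` Z)"
    by (rule block_union_iff_closed_under_map[OF pb, symmetric]) (use Y Z in auto)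
  finally show ?thesis .
qed

text \<open>
  The case \<open>M = range Middle\<close> of the count above: the blocks contained in \<open>M\<close> are then the floating
  components.
\<close>

lemma card_intermediate_subsets:
  assumes a: "a \<in> partitions m n" and b: "b \<in> partitions n t"
    and X: "X \<subseteq> {1..m}" and Z: "Z \<subseteq> {1..t}"
  shows "card {Y \<in> Pow {1..n}. block_union a (Upper ` X \<union> Lower ` Y) \<and>
                               block_union b (Upper ` Y \<union> Lower ` Z)} =
    (if block_union (part_mult a b) (Upper ` X \<union> Lower ` Z) then 2 ^ floating a b else 0)"
proof -
  let ?U = "Upper ` X \<union> Lower ` Z"
  let ?A = "{Y \<in> Pow {1..n}. block_union a (Upper ` X \<union> Lower ` Y) \<and>
                             block_union b (Upper ` Y \<union> Lower ` Z)}"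
  let ?B = "{Y. Y \<subseteq> range Middle \<and> block_union (prod_components a b) (?U \<union> Y)}"
  have inj: "inj_on ((`) Middle) ?A"
    by (auto simp: inj_on_def inj_image_eq_iff)
  have "(`) Middle ` ?A = ?B"
  proof
    show "(`) Middle ` ?A \<subseteq> ?B"
      using block_union_prod_components_iff[OF a b X _ Z] by auto
    show "?B \<subseteq> (`) Middle ` ?A"
    proof
      fix T assume T: "T \<in> ?B"
      then obtain Y where Y: "T = Middle ` Y" by (auto simp: subset_image_iff)
      have bu: "block_union (prod_components a b) (?U \<union> Middle ` Y)" using T Y by simp
      then have "Middle ` Y \<subseteq> prod_vertices a b"
        using block_union_subset[OF bu] partition_onD1[OF partition_on_prod_components[of a b]]
        by simp
      then have Yn: "Y \<subseteq> {1..n}" by (auto simp: prod_vertices_eq[OF a b])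
      have "Y \<in> ?A" using bu Yn block_union_prod_components_iff[OF a b X Yn Z] by simp
      then show "T \<in> (`) Middle ` ?A" unfolding Y by (rule imageI)
    qed
  qed
  then have "card ?A = card ?B" using card_image[OF inj] by simp
  also have "\<dots> = (if block_union (part_mult a b) ?U then 2 ^ floating a b else 0)"
    unfolding part_mult_eq floating_def
    by (rule card_block_union_extensions[OF partition_on_prod_components finite_prod_components[OF a b]])
      auto
  finally show ?thesis .
qed

section \<open>Matrices indexed by subsets\<close>

text \<open>
  The element \<open>x\<close> stands for the binary digit at position \<open>n - x\<close>, so injectivity is
  uniqueness of binary expansions.
\<close>

lemma subset_index_eq_set_encode:
  assumes "X \<subseteq> {1..n}"
  shows "subset_index n X = set_encode ((\<lambda>x. n - x) ` X)"
proof -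
  have "inj_on (\<lambda>x. n - x) {1..n}" by (auto simp: inj_on_def)
  then have "inj_on (\<lambda>x. n - x) X" using assms by (rule inj_on_subset)
  then show ?thesis by (simp add: subset_index_def set_encode_def sum.reindex)
qed

lemma subset_index_less:
  assumes "X \<subseteq> {1..n}"
  shows "subset_index n X < 2 ^ n"
proof -
  have "(\<lambda>x. n - x) ` X \<subseteq> {..<n}" using assms by auto
  then have "set_encode ((\<lambda>x. n - x) ` X) \<le> (\<Sum>i<n. 2 ^ i)"
    unfolding set_encode_def by (intro sum_mono2) auto
  also have "\<dots> < 2 ^ n" using sum_power2[of n] by (simp add: lessThan_atLeast0)
  finally show ?thesis using assms by (simp add: subset_index_eq_set_encode)
qed

lemma bij_betw_subset_index: "bij_betw (subset_index n) (Pow {1..n}) {..<2 ^ n}"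
proof -
  have inj: "inj_on (subset_index n) (Pow {1..n})"
  proof (rule inj_onI)
    fix X Y assume XY: "X \<in> Pow {1..n}" "Y \<in> Pow {1..n}" "subset_index n X = subset_index n Y"
    have "finite X" "finite Y" using XY by (auto intro: finite_subset)
    then have "(\<lambda>x. n - x) ` X = (\<lambda>x. n - x) ` Y"
      using XY by (simp add: subset_index_eq_set_encode set_encode_eq)
    moreover have "inj_on (\<lambda>x. n - x) {1..n}" by (auto simp: inj_on_def)
    ultimately show "X = Y" using XY by (simp add: inj_on_image_eq_iff)
  qed
  have "subset_index n ` Pow {1..n} = {..<2 ^ n}"
  proof (rule card_subset_eq)
    show "subset_index n ` Pow {1..n} \<subseteq> {..<2 ^ n}" using subset_index_less by blast
    show "card (subset_index n ` Pow {1..n}) = card {..<2 ^ n :: nat}"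
      unfolding card_image[OF inj] by (simp add: card_Pow)
  qed simp
  with inj show ?thesis by (simp add: bij_betw_def)
qed

lemma subset_index_eq_iff:
  assumes "X \<subseteq> {1..n}" "Y \<subseteq> {1..n}"
  shows "subset_index n X = subset_index n Y \<longleftrightarrow> X = Y"
  using inj_on_eq_iff[OF bij_betw_imp_inj_on[OF bij_betw_subset_index]] assms by blast

lemma index_subset_subset_index [simp]:
  "X \<subseteq> {1..n} \<Longrightarrow> index_subset n (subset_index n X) = X"
  unfolding index_subset_def
  by (rule the_inv_into_f_f[OF bij_betw_imp_inj_on[OF bij_betw_subset_index]]) auto

text \<open>
  Concatenation of digit strings: the digits of \<open>X\<close> are the high ones, so quotient and remainder
  by \<open>2 ^ s\<close> recover the two indices, as in the definition of \<open>kronecker\<close>.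
\<close>

lemma subset_index_append:
  assumes "X \<subseteq> {1..m}" "U \<subseteq> {1..s}"
  shows "subset_index (m + s) (X \<union> (\<lambda>x. x + m) ` U) =
    subset_index m X * 2 ^ s + subset_index s U"
proof -
  have fin: "finite X" "finite U" using assms by (auto intro: finite_subset)
  have "subset_index (m + s) (X \<union> (\<lambda>x. x + m) ` U) =
      (\<Sum>x\<in>X. 2 ^ (m + s - x)) + (\<Sum>x\<in>(\<lambda>x. x + m) ` U. 2 ^ (m + s - x))"
    unfolding subset_index_def using assms fin by (intro sum.union_disjoint) fastforce+
  also have "(\<Sum>x\<in>X. 2 ^ (m + s - x)) = (\<Sum>x\<in>X. 2 ^ (m - x) * (2::nat) ^ s)"
    using assms by (intro sum.cong) (auto simp: subset_iff simp flip: power_add)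
  also have "(\<Sum>x\<in>(\<lambda>x. x + m) ` U. 2 ^ (m + s - x)) = (\<Sum>x\<in>U. (2::nat) ^ (s - x))"
    by (subst sum.reindex) auto
  finally show ?thesis by (simp add: subset_index_def sum_distrib_right)
qed

lemma subset_indexed_mat_eqI:
  assumes A: "A \<in> carrier_mat (2 ^ m) (2 ^ n)" and B: "B \<in> carrier_mat (2 ^ m) (2 ^ n)"
    and eq: "\<And>X Y. X \<subseteq> {1..m} \<Longrightarrow> Y \<subseteq> {1..n} \<Longrightarrow>
      A $$ (subset_index m X, subset_index n Y) = B $$ (subset_index m X, subset_index n Y)"
  shows "A = B"
proof (rule eq_matI)
  fix i j assume "i < dim_row B" "j < dim_col B"
  then have "i \<in> subset_index m ` Pow {1..m}" "j \<in> subset_index n ` Pow {1..n}"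
    using B bij_betw_subset_index by (auto simp: bij_betw_def)
  then show "A $$ (i, j) = B $$ (i, j)" using eq by auto
qed (use A B in auto)

lemma rho_carrier:
  "a \<in> partitions m n \<Longrightarrow> (rho (i, a) :: 'k::semiring_1 mat) \<in> carrier_mat (2 ^ m) (2 ^ n)"
  by (simp add: rho_def part_matrix_def Let_def)

text \<open>
  The entry is given as the image of a natural number because sums of entries are then counts,
  and because natural numbers commute with every element of the semiring.
\<close>

lemma rho_entry:
  assumes "a \<in> partitions m n" "X \<subseteq> {1..m}" "Y \<subseteq> {1..n}"
  shows "rho (i, a) $$ (subset_index m X, subset_index n Y) =
    (of_nat (if block_union a (Upper ` X \<union> Lower ` Y) then 2 ^ i else 0) :: 'k::semiring_1)"
  using assms
  by (auto simp: rho_def part_matrix_def Let_def block_union_def subset_index_less)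

lemma subset_indexed_mult_entry:
  assumes A: "A \<in> carrier_mat (2 ^ m) (2 ^ n)" and B: "B \<in> carrier_mat (2 ^ n) (2 ^ t)"
    and X: "X \<subseteq> {1..m}" and Z: "Z \<subseteq> {1..t}"
  shows "(A * B) $$ (subset_index m X, subset_index t Z) =
    (\<Sum>Y\<in>Pow {1..n}. A $$ (subset_index m X, subset_index n Y) *
                        B $$ (subset_index n Y, subset_index t Z))"
proof -
  have "(A * B) $$ (subset_index m X, subset_index t Z) =
    (\<Sum>k<2 ^ n. A $$ (subset_index m X, k) * B $$ (k, subset_index t Z))"
    using A B subset_index_less[OF X] subset_index_less[OF Z]
    by (auto simp: scalar_prod_def lessThan_atLeast0 intro!: sum.cong)
  then show ?thesis by (simp add: sum.reindex_bij_betw[OF bij_betw_subset_index, symmetric])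
qed

lemma subset_indexed_kronecker_entry:
  assumes A: "A \<in> carrier_mat (2 ^ m) (2 ^ n)" and B: "B \<in> carrier_mat (2 ^ s) (2 ^ t)"
    and "X \<subseteq> {1..m}" "Y \<subseteq> {1..n}" "U \<subseteq> {1..s}" "V \<subseteq> {1..t}"
  shows "kronecker A B $$ (subset_index (m + s) (X \<union> (\<lambda>x. x + m) ` U),
                           subset_index (n + t) (Y \<union> (\<lambda>x. x + n) ` V)) =
    A $$ (subset_index m X, subset_index n Y) * B $$ (subset_index s U, subset_index t V)"
proof -
  have lt: "subset_index (m + s) (X \<union> (\<lambda>x. x + m) ` U) < 2 ^ m * 2 ^ s"
    "subset_index (n + t) (Y \<union> (\<lambda>x. x + n) ` V) < 2 ^ n * 2 ^ t"
    unfolding power_add[symmetric] using assms(3-6) by (fastforce intro!: subset_index_less)+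
  have "subset_index s U < 2 ^ s" "subset_index t V < 2 ^ t"
    by (simp_all only: subset_index_less assms(5,6))
  then show ?thesis
    using A B lt assms(3-6) by (simp add: kronecker_def subset_index_append)
qed

section \<open>Values of the representation\<close>

lemma rho_mult:
  assumes a: "a \<in> partitions m n" and b: "b \<in> partitions n t"
  shows "rho (i + j + floating a b, part_mult a b) = (rho (i, a) * rho (j, b) :: 'k::semiring_1 mat)"
    (is "?L = ?A * ?B")
proof (rule subset_indexed_mat_eqI[of _ m t])
  show "?L \<in> carrier_mat (2 ^ m) (2 ^ t)" by (rule rho_carrier[OF part_mult_closed[OF a b]])
  show "?A * ?B \<in> carrier_mat (2 ^ m) (2 ^ t)"
    by (rule mult_carrier_mat[OF rho_carrier[OF a] rho_carrier[OF b]])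
  fix X Z assume X: "X \<subseteq> {1..m}" and Z: "Z \<subseteq> {1..t}"
  let ?P = "\<lambda>Y. block_union a (Upper ` X \<union> Lower ` Y) \<and> block_union b (Upper ` Y \<union> Lower ` Z)"
  have "(?A * ?B) $$ (subset_index m X, subset_index t Z) =
      (\<Sum>Y\<in>Pow {1..n}. of_nat (if ?P Y then 2 ^ (i + j) else 0))"
    unfolding subset_indexed_mult_entry[OF rho_carrier[OF a] rho_carrier[OF b] X Z]
    by (intro sum.cong) (auto simp: rho_entry[OF a X] rho_entry[OF b _ Z] power_add)
  also have "\<dots> = of_nat (\<Sum>Y\<in>Pow {1..n}. if ?P Y then 2 ^ (i + j) else 0)"
    by (simp only: of_nat_sum)
  also have "(\<Sum>Y\<in>Pow {1..n}. if ?P Y then 2 ^ (i + j) else 0) =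
      (2::nat) ^ (i + j) * card {Y \<in> Pow {1..n}. ?P Y}"
    by (simp add: sum.inter_filter[symmetric] mult.commute)
  finally show "?L $$ (subset_index m X, subset_index t Z) =
      (?A * ?B) $$ (subset_index m X, subset_index t Z)"
    unfolding rho_entry[OF part_mult_closed[OF a b] X Z] card_intermediate_subsets[OF a b X Z]
    by (simp add: power_add)
qed

lemma part_id_eq_image: "part_id n = (\<lambda>i. {Upper i, Lower i}) ` {1..n}"
  by (auto simp: part_id_def)

lemma part_id_closed: "part_id n \<in> partitions n n"
  unfolding partitions_def part_id_eq_image mem_Collect_eq
  by (rule partition_onI) (auto simp: disjnt_def)

lemma rho_id: "rho (0, part_id n) = (1\<^sub>m (2 ^ n) :: 'k::semiring_1 mat)"
proof (rule subset_indexed_mat_eqI[of _ n n])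
  fix X Y assume X: "X \<subseteq> {1..n}" and Y: "Y \<subseteq> {1..n}"
  have p: "partition_on (Upper ` {1..n} \<union> Lower ` {1..n}) (part_id n)"
    using part_id_closed by (simp add: partitions_def)
  let ?T = "Upper ` X \<union> Lower ` Y"
  have sub: "?T \<subseteq> Upper ` {1..n} \<union> Lower ` {1..n}" using X Y by auto
  have "{Upper i, Lower i} \<inter> ?T \<noteq> {} \<longleftrightarrow> i \<in> X \<or> i \<in> Y"
    "{Upper i, Lower i} \<subseteq> ?T \<longleftrightarrow> i \<in> X \<and> i \<in> Y" for i by auto
  then have "block_union (part_id n) ?T \<longleftrightarrow>
      (\<forall>i\<in>{1..n}. i \<in> X \<or> i \<in> Y \<longrightarrow> i \<in> X \<and> i \<in> Y)"
    unfolding block_union_iff_saturated[OF p] by (simp only: part_id_eq_image ball_simps sub simp_thms)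
  also have "\<dots> \<longleftrightarrow> X = Y" using X Y by blast
  finally show "rho (0, part_id n) $$ (subset_index n X, subset_index n Y) =
      (1\<^sub>m (2 ^ n) :: 'k mat) $$ (subset_index n X, subset_index n Y)"
    using X Y by (simp add: rho_entry[OF part_id_closed] subset_index_less subset_index_eq_iff)
qed (auto intro: rho_carrier[OF part_id_closed])

lemma flip_flip [simp]: "flip (flip v) = v"
  by (cases v) auto

lemma inj_flip: "inj flip"
  by (metis flip_flip injI)

lemma part_star_closed:
  assumes "a \<in> partitions m n"
  shows "part_star a \<in> partitions n m"
proof -
  have "partition_on (flip ` (Upper ` {1..m} \<union> Lower ` {1..n})) ((`) flip ` a - {{}})"
    using assms inj_flip by (intro partition_on_inj_image) (auto simp: partitions_def inj_on_def inj_def)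
  moreover have "{} \<notin> (`) flip ` a" using assms by (auto simp: partitions_def partition_on_def)
  ultimately show ?thesis
    by (simp add: part_star_def partitions_def image_Un image_image Un_commute)
qed

lemma rho_star:
  assumes a: "a \<in> partitions m n"
  shows "rho (i, part_star a) = (transpose_mat (rho (i, a)) :: 'k::semiring_1 mat)"
proof (rule subset_indexed_mat_eqI[of _ n m])
  show "rho (i, part_star a) \<in> carrier_mat (2 ^ n) (2 ^ m)"
    by (rule rho_carrier[OF part_star_closed[OF a]])
  show "transpose_mat (rho (i, a)) \<in> carrier_mat (2 ^ n) (2 ^ m)"
    using rho_carrier[OF a] by simp
  fix Y X assume Y: "Y \<subseteq> {1..n}" and X: "X \<subseteq> {1..m}"
  have "flip ` (Upper ` X \<union> Lower ` Y) = Upper ` Y \<union> Lower ` X"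
    by (simp add: image_Un image_image Un_commute)
  then have "block_union (part_star a) (Upper ` Y \<union> Lower ` X) \<longleftrightarrow>
      block_union a (Upper ` X \<union> Lower ` Y)"
    using block_union_image[OF inj_flip, of a] by (metis part_star_def subset_UNIV)
  moreover have "transpose_mat (rho (i, a) :: 'k mat) $$ (subset_index n Y, subset_index m X) =
      rho (i, a) $$ (subset_index m X, subset_index n Y)"
    using subset_index_less[OF X] subset_index_less[OF Y] rho_carrier[OF a]
    by (metis carrier_matD index_transpose_mat(1))
  ultimately show "rho (i, part_star a) $$ (subset_index n Y, subset_index m X) =
      transpose_mat (rho (i, a) :: 'k mat) $$ (subset_index n Y, subset_index m X)"
    by (simp add: rho_entry[OF a X Y] rho_entry[OF part_star_closed[OF a] Y X])
qed

lemma inj_shift: "inj (shift m n)"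
proof (rule injI)
  fix v w assume "shift m n v = shift m n w"
  then show "v = w" by (cases v; cases w) auto
qed

lemma shift_image: "shift m n ` (Upper ` U \<union> Lower ` V) =
    Upper ` (\<lambda>x. x + m) ` U \<union> Lower ` (\<lambda>x. x + n) ` V"
  by (simp add: image_Un image_image)

lemma atLeastAtMost_append: "{1..m + s} = {1..m} \<union> (\<lambda>x. x + m) ` {1..s::nat}"
proof -
  have "(\<lambda>x. x + m) ` {1..s} = {1 + m..s + m}" by (rule image_add_atLeastAtMost')
  then show ?thesis by auto
qed

lemma subset_append_cases:
  assumes "W \<subseteq> {1..m + s::nat}"
  obtains X U where "X \<subseteq> {1..m}" "U \<subseteq> {1..s}" "W = X \<union> (\<lambda>x. x + m) ` U"
proof -
  have "W \<inter> (\<lambda>x. x + m) ` {1..s} \<subseteq> (\<lambda>x. x + m) ` {1..s}" by blast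
  then obtain U where "U \<subseteq> {1..s}" "W \<inter> (\<lambda>x. x + m) ` {1..s} = (\<lambda>x. x + m) ` U"
    by (meson subset_imageE)
  moreover have "W = (W \<inter> {1..m}) \<union> (W \<inter> (\<lambda>x. x + m) ` {1..s})"
    using assms unfolding atLeastAtMost_append by blast
  ultimately show thesis using that[of "W \<inter> {1..m}" U] by auto
qed

lemma part_oplus_closed:
  assumes a: "a \<in> partitions m n" and b: "b \<in> partitions s t"
  shows "part_oplus a b \<in> partitions (m + s) (n + t)"
proof -
  let ?W = "Upper ` {1..s} \<union> Lower ` {1..t}"
  have "partition_on (shift m n ` ?W) ((`) (shift m n) ` b - {{}})"
    using b inj_shift by (intro partition_on_inj_image) (auto simp: partitions_def inj_on_def inj_def)
  moreover have "{} \<notin> (`) (shift m n) ` b" using b by (auto simp: partitions_def partition_on_def)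
  ultimately have "partition_on (shift m n ` ?W) ((`) (shift m n) ` b)" by simp
  moreover have "partition_on (Upper ` {1..m} \<union> Lower ` {1..n}) a"
    using a by (simp add: partitions_def)
  moreover have "(Upper ` {1..m} \<union> Lower ` {1..n}) \<inter> shift m n ` ?W = {}" by auto
  ultimately have "partition_on ((Upper ` {1..m} \<union> Lower ` {1..n}) \<union> shift m n ` ?W)
      (part_oplus a b)"
    using a by (simp add: part_oplus_def partition_on_Un_disjoint)
  moreover have "(Upper ` {1..m} \<union> Lower ` {1..n}) \<union> shift m n ` ?W =
      Upper ` {1..m + s} \<union> Lower ` {1..n + t}"
    unfolding shift_image atLeastAtMost_append by blast
  ultimately show ?thesis by (simp add: partitions_def)
qed

lemma rho_oplus:
  assumes a: "a \<in> partitions m n" and b: "b \<in> partitions s t"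
  shows "rho (i + j, part_oplus a b) = (kronecker (rho (i, a)) (rho (j, b)) :: 'k::semiring_1 mat)"
proof (rule subset_indexed_mat_eqI[of _ "m + s" "n + t"])
  show "rho (i + j, part_oplus a b) \<in> carrier_mat (2 ^ (m + s)) (2 ^ (n + t))"
    by (rule rho_carrier[OF part_oplus_closed[OF a b]])
  show "kronecker (rho (i, a)) (rho (j, b) :: 'k mat) \<in> carrier_mat (2 ^ (m + s)) (2 ^ (n + t))"
    using carrier_matD[OF rho_carrier[where 'k = 'k, OF a, of i]]
      carrier_matD[OF rho_carrier[where 'k = 'k, OF b, of j]]
    by (intro carrier_matI) (simp_all add: kronecker_def power_add)
  fix W W' assume W: "W \<subseteq> {1..m + s}" and W': "W' \<subseteq> {1..n + t}"
  from W obtain X U where X: "X \<subseteq> {1..m}" and U: "U \<subseteq> {1..s}" and WX: "W = X \<union> (\<lambda>x. x + m) ` U"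
    by (rule subset_append_cases)
  from W' obtain Y V where Y: "Y \<subseteq> {1..n}" and V: "V \<subseteq> {1..t}" and WY: "W' = Y \<union> (\<lambda>x. x + n) ` V"
    by (rule subset_append_cases)
  let ?A = "Upper ` {1..m} \<union> Lower ` {1..n}" and ?B = "Upper ` {1..s} \<union> Lower ` {1..t}"
  have T: "Upper ` W \<union> Lower ` W' = (Upper ` X \<union> Lower ` Y) \<union> shift m n ` (Upper ` U \<union> Lower ` V)"
    unfolding WX WY shift_image by blast
  have iff: "block_union (part_oplus a b) (Upper ` W \<union> Lower ` W') \<longleftrightarrow>
      block_union a (Upper ` X \<union> Lower ` Y) \<and> block_union b (Upper ` U \<union> Lower ` V)"
    unfolding T part_oplus_def upper_size_eq[OF a] lower_size_eq[OF a]
      block_union_image[OF inj_shift subset_UNIV subset_UNIV, of m n b, symmetric]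
  proof (rule block_union_Un)
    show "\<Union>a \<subseteq> ?A" by (simp only: Union_partitions[OF a] order_refl)
    show "\<Union>((`) (shift m n) ` b) \<subseteq> shift m n ` ?B"
      by (simp only: image_Union[symmetric] Union_partitions[OF b] order_refl)
    show "?A \<inter> shift m n ` ?B = {}" by auto
    show "Upper ` X \<union> Lower ` Y \<subseteq> ?A" using X Y by auto
    have "Upper ` U \<union> Lower ` V \<subseteq> ?B" using U V by auto
    then show "shift m n ` (Upper ` U \<union> Lower ` V) \<subseteq> shift m n ` ?B" by (rule image_mono)
  qed
  show "rho (i + j, part_oplus a b) $$ (subset_index (m + s) W, subset_index (n + t) W') =
      kronecker (rho (i, a)) (rho (j, b) :: 'k mat) $$ (subset_index (m + s) W, subset_index (n + t) W')"
    unfolding rho_entry[OF part_oplus_closed[OF a b] W W'] iff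
    unfolding WX WY subset_indexed_kronecker_entry[OF rho_carrier[OF a] rho_carrier[OF b] X Y U V]
      rho_entry[OF a X Y] rho_entry[OF b U V]
    by (simp add: power_add)
qed

text \<open>
  If \<open>p < q\<close> had the same multiple of \<open>1\<close>, then replacing \<open>q\<close> by \<open>p\<close> repeatedly would bring every
  multiple of \<open>1\<close> into a finite list.
\<close>

lemma inj_of_nat_if_characteristic_0:
  assumes "semiring_characteristic_0 TYPE('k::semiring_1)"
  shows "inj (of_nat :: nat \<Rightarrow> 'k)"
proof (rule ccontr)
  assume "\<not> inj (of_nat :: nat \<Rightarrow> 'k)"
  then obtain p q where "p \<noteq> q" "(of_nat p :: 'k) = of_nat q" by (auto simp: inj_def)
  then obtain p q where pq: "p < q" "(of_nat p :: 'k) = of_nat q"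
    by (metis linorder_neqE_nat)
  have "(of_nat k :: 'k) \<in> of_nat ` {..<q}" for k
  proof (induction k rule: less_induct)
    case (less k)
    show ?case
    proof (cases "k < q")
      case False
      then have "(of_nat k :: 'k) = of_nat (k - q) + of_nat q" by (simp flip: of_nat_add)
      also have "\<dots> = of_nat (k - q + p)" using pq by simp
      finally show ?thesis using less.IH[of "k - q + p"] False pq by simp
    qed auto
  qed
  then have "{of_nat k :: 'k | k. k \<ge> 1} \<subseteq> of_nat ` {..<q}" by blast
  then show False
    using assms finite_surj[of "{..<q}"] by (auto simp: semiring_characteristic_0_def)
qed

lemma rho_eq_imp_eq:
  assumes inj: "inj (of_nat :: nat \<Rightarrow> 'k::semiring_1)"
    and a: "a \<in> partitions m n" and b: "b \<in> partitions m n"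
    and eq: "rho (i, a) = (rho (j, b) :: 'k mat)"
  shows "i = j \<and> a = b"
proof -
  have entry: "(if block_union a (Upper ` X \<union> Lower ` Y) then 2 ^ i else 0) =
      (if block_union b (Upper ` X \<union> Lower ` Y) then 2 ^ j else 0 :: nat)"
    if "X \<subseteq> {1..m}" "Y \<subseteq> {1..n}" for X Y
    using arg_cong[OF eq, of "\<lambda>A. A $$ (subset_index m X, subset_index n Y)"] inj
    unfolding rho_entry[OF a that] rho_entry[OF b that] by (simp only: inj_eq)
  have ij: "i = j" using entry[of "{}" "{}"] by simp
  have "a = b"
  proof (rule partition_eq_if_block_unions)
    show "partition_on (Upper ` {1..m} \<union> Lower ` {1..n}) a" using a by (simp add: partitions_def)
    show "partition_on (Upper ` {1..m} \<union> Lower ` {1..n}) b" using b by (simp add: partitions_def)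
    fix T assume "T \<subseteq> Upper ` {1..m} \<union> Lower ` {1..n}"
    then obtain T1 T2 where T: "T = T1 \<union> T2" "T1 \<subseteq> Upper ` {1..m}" "T2 \<subseteq> Lower ` {1..n}"
      by (meson subset_UnE)
    from T(2) obtain X where "X \<subseteq> {1..m}" "T1 = Upper ` X" by (rule subset_imageE)
    moreover from T(3) obtain Y where "Y \<subseteq> {1..n}" "T2 = Lower ` Y" by (rule subset_imageE)
    ultimately have "X \<subseteq> {1..m}" "Y \<subseteq> {1..n}" "T = Upper ` X \<union> Lower ` Y" using T(1) by auto
    with entry[of X Y] show "block_union a T \<longleftrightarrow> block_union b T" by (auto split: if_splits)
  qed
  with ij show ?thesis by simp
qed

section \<open>The categories and the functor\<close>

text \<open>
  The axioms of a category are equations between parallel morphisms.  They can be checked after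
  applying a map that respects composition and identities and is injective on hom-sets.
\<close>

lemma category_if_faithful_image:
  assumes D: "category D"
    and disj: "\<And>x y x' y' f. \<lbrakk>x \<in> Obj C; y \<in> Obj C; x' \<in> Obj C; y' \<in> Obj C;
        f \<in> Hom C x y; f \<in> Hom C x' y'\<rbrakk> \<Longrightarrow> x = x' \<and> y = y'"
    and idc: "\<And>x. x \<in> Obj C \<Longrightarrow> Id C x \<in> Hom C x x"
    and compc: "\<And>x y z f g. \<lbrakk>x \<in> Obj C; y \<in> Obj C; z \<in> Obj C; f \<in> Hom C x y; g \<in> Hom C y z\<rbrakk>
        \<Longrightarrow> Comp C f g \<in> Hom C x z"
    and objF: "\<And>x. x \<in> Obj C \<Longrightarrow> G x \<in> Obj D"
    and homF: "\<And>x y f. \<lbrakk>x \<in> Obj C; y \<in> Obj C; f \<in> Hom C x y\<rbrakk> \<Longrightarrow> F f \<in> Hom D (G x) (G y)"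
    and idF: "\<And>x. x \<in> Obj C \<Longrightarrow> F (Id C x) = Id D (G x)"
    and compF: "\<And>x y z f g. \<lbrakk>x \<in> Obj C; y \<in> Obj C; z \<in> Obj C; f \<in> Hom C x y; g \<in> Hom C y z\<rbrakk>
        \<Longrightarrow> F (Comp C f g) = Comp D (F f) (F g)"
    and injF: "\<And>x y. \<lbrakk>x \<in> Obj C; y \<in> Obj C\<rbrakk> \<Longrightarrow> inj_on F (Hom C x y)"
  shows "category C"
proof -
  interpret D: category D by (rule D)
  show ?thesis
  proof
    fix w x y z f g h
    assume o: "w \<in> Obj C" "x \<in> Obj C" "y \<in> Obj C" "z \<in> Obj C"
      and h: "f \<in> Hom C w x" "g \<in> Hom C x y" "h \<in> Hom C y z"
    have fg: "Comp C f g \<in> Hom C w y" and gh: "Comp C g h \<in> Hom C x z"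
      using compc o h by blast+
    have "F (Comp C (Comp C f g) h) = Comp D (Comp D (F f) (F g)) (F h)"
      by (simp add: compF[OF o(1,3,4) fg h(3)] compF[OF o(1,2,3) h(1,2)])
    also have "\<dots> = Comp D (F f) (Comp D (F g) (F h))"
      by (rule D.Comp_assoc[OF objF[OF o(1)] objF[OF o(2)] objF[OF o(3)] objF[OF o(4)]
            homF[OF o(1,2) h(1)] homF[OF o(2,3) h(2)] homF[OF o(3,4) h(3)]])
    also have "\<dots> = F (Comp C f (Comp C g h))"
      by (simp add: compF[OF o(1,2,4) h(1) gh] compF[OF o(2,3,4) h(2,3)])
    finally show "Comp C (Comp C f g) h = Comp C f (Comp C g h)"
      using inj_onD[OF injF[OF o(1,4)]] compc[OF o(1,3,4) fg h(3)] compc[OF o(1,2,4) h(1) gh]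
      by blast
  next
    fix x y f assume o: "x \<in> Obj C" "y \<in> Obj C" and f: "f \<in> Hom C x y"
    have "F (Comp C (Id C x) f) = F f"
      using compF[OF o(1,1,2) idc[OF o(1)] f] idF[OF o(1)]
        D.Id_left[OF objF[OF o(1)] objF[OF o(2)] homF[OF o f]] by simp
    then show "Comp C (Id C x) f = f"
      using inj_onD[OF injF[OF o]] compc[OF o(1,1,2) idc[OF o(1)] f] f by blast
    have "F (Comp C f (Id C y)) = F f"
      using compF[OF o(1,2,2) f idc[OF o(2)]] idF[OF o(2)]
        D.Id_right[OF objF[OF o(1)] objF[OF o(2)] homF[OF o f]] by simp
    then show "Comp C f (Id C y) = f"
      using inj_onD[OF injF[OF o]] compc[OF o(1,2,2) f idc[OF o(2)]] f by blast
  qed (use disj idc compc in blast)+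
qed

lemma category_matrix_category: "category (matrix_category :: (nat, 'k::semiring_1 mat) tcat)"
proof
  fix w x y z and f g h :: "'k mat"
  let ?M = "matrix_category :: (nat, 'k mat) tcat"
  assume "f \<in> Hom ?M w x" "g \<in> Hom ?M x y" "h \<in> Hom ?M y z"
  then show "Comp ?M (Comp ?M f g) h = Comp ?M f (Comp ?M g h)"
    by (simp add: matrix_category_def assoc_mult_mat)
qed (auto simp: matrix_category_def)

lemma monoid_End_monoid:
  assumes "category C" "x \<in> Obj C"
  shows "monoid (End_monoid C x)"
proof -
  interpret category C by fact
  show ?thesis
    using assms(2)
    by (auto intro!: monoidI simp: End_monoid_def Id_closed Comp_closed Comp_assoc Id_left Id_right)
qed

lemma Mor_twisted_partition_category:
  "f \<in> Mor twisted_partition_category \<longleftrightarrow> (\<exists>i a m n. f = (i, a) \<and> a \<in> partitions m n)"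
  by (cases f) (auto simp: Mor_def twisted_partition_category_def)

lemma partitions_determine_sizes:
  "\<lbrakk>a \<in> partitions m n; a \<in> partitions m' n'\<rbrakk> \<Longrightarrow> m = m' \<and> n = n'"
  by (metis upper_size_eq lower_size_eq)

lemma category_twisted_partition_category: "category twisted_partition_category"
  \<comment> \<open>Any semiring of characteristic \<open>0\<close> would do as the scalars here.\<close>
proof (rule category_if_faithful_image[of "matrix_category :: (nat, nat mat) tcat" _ rho_obj rho])
  show "category (matrix_category :: (nat, nat mat) tcat)" by (rule category_matrix_category)
  show "inj_on (rho :: _ \<Rightarrow> nat mat) (Hom twisted_partition_category m n)" for m n
    by (rule inj_onI)
      (auto simp: twisted_partition_category_def dest: rho_eq_imp_eq[where 'k = nat, rotated -1]
        intro: inj_onI)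
qed (auto simp: twisted_partition_category_def matrix_category_def rho_obj_def rho_carrier rho_id
    rho_mult part_id_closed part_mult_closed dest: partitions_determine_sizes)

theorem theorem4p1:
  assumes "semiring_characteristic_0 TYPE('k::semiring_1)"
  shows
    "(let P = twisted_partition_category;
          M = (matrix_category :: (nat, 'k mat) tcat);
          \<rho> = (rho :: nat \<times> vertex set set \<Rightarrow> 'k mat)
      in faithful_representation P M rho_obj \<rho> \<and>
         involutive_representation P M rho_obj \<rho> \<and>
         tensor_representation P M rho_obj \<rho> \<and>
         (\<forall>n. monoid (End_monoid P n) \<and> monoid (End_monoid M (2 ^ n)) \<and>
              \<rho> \<in> hom (End_monoid P n) (End_monoid M (2 ^ n)) \<and>
              \<rho> \<one>\<^bsub>End_monoid P n\<^esub> = \<one>\<^bsub>End_monoid M (2 ^ n)\<^esub> \<and>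
              inj_on \<rho> (carrier (End_monoid P n)) \<and>
              (\<forall>f\<in>carrier (End_monoid P n). \<rho> (Invol P f) = Invol M (\<rho> f))))"
proof -
  let ?P = twisted_partition_category
  let ?M = "matrix_category :: (nat, 'k mat) tcat"
  let ?\<rho> = "rho :: nat \<times> vertex set set \<Rightarrow> 'k mat"
  have ObjP: "x \<in> Obj ?P" and ObjM: "y \<in> Obj ?M" for x y
    by (simp_all add: twisted_partition_category_def matrix_category_def)
  interpret P: category ?P by (rule category_twisted_partition_category)
  interpret M: category ?M by (rule category_matrix_category)
  interpret category_representation ?P ?M rho_obj ?\<rho>
    by unfold_locales
      (auto simp: twisted_partition_category_def matrix_category_def rho_obj_def rho_carrier rho_id
        rho_mult)
  have inj: "inj_on ?\<rho> (Mor ?P)"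
  proof (rule inj_onI)
    fix f g assume f: "f \<in> Mor ?P" and g: "g \<in> Mor ?P" and eq: "?\<rho> f = ?\<rho> g"
    obtain i a m n where f': "f = (i, a)" and a: "a \<in> partitions m n"
      using f unfolding Mor_twisted_partition_category by blast
    obtain j b m' n' where g': "g = (j, b)" and b: "b \<in> partitions m' n'"
      using g unfolding Mor_twisted_partition_category by blast
    have e: "rho (i, a) = (rho (j, b) :: 'k mat)" using eq by (simp only: f' g')
    \<comment> \<open>The matrix remembers its dimensions, so morphisms of different hom-sets stay distinct.\<close>
    have "(2::nat) ^ m = 2 ^ m'" "(2::nat) ^ n = 2 ^ n'"
      using carrier_matD[OF rho_carrier[where 'k = 'k, OF a, of i]]
        carrier_matD[OF rho_carrier[where 'k = 'k, OF b, of j]] e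
      by metis+
    then have "m = m'" "n = n'" by simp_all
    then show "f = g"
      using rho_eq_imp_eq[OF inj_of_nat_if_characteristic_0[OF assms] a _ e] b f' g' by simp
  qed
  have invol: "?\<rho> (Invol ?P f) = Invol ?M (?\<rho> f)" if "f \<in> Mor ?P" for f
    using that unfolding Mor_twisted_partition_category
    by (auto simp: twisted_partition_category_def matrix_category_def rho_star)
  have tensor: "?\<rho> (Tensor ?P f g) = Tensor ?M (?\<rho> f) (?\<rho> g)" if "f \<in> Mor ?P" "g \<in> Mor ?P" for f g
    using that unfolding Mor_twisted_partition_category
    by (auto simp: twisted_partition_category_def matrix_category_def rho_oplus)
  have "faithful_representation ?P ?M rho_obj ?\<rho>"
    by unfold_locales (use inj in \<open>auto simp: rho_obj_def inj_on_def\<close>)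
  moreover have "involutive_representation ?P ?M rho_obj ?\<rho>"
    by unfold_locales (rule invol)
  moreover have "tensor_representation ?P ?M rho_obj ?\<rho>"
    by unfold_locales
      (use tensor in \<open>auto simp: twisted_partition_category_def matrix_category_def rho_obj_def power_add\<close>)
  moreover have "\<forall>n. monoid (End_monoid ?P n) \<and> monoid (End_monoid ?M (2 ^ n)) \<and>
      ?\<rho> \<in> hom (End_monoid ?P n) (End_monoid ?M (2 ^ n)) \<and>
      ?\<rho> \<one>\<^bsub>End_monoid ?P n\<^esub> = \<one>\<^bsub>End_monoid ?M (2 ^ n)\<^esub> \<and>
      inj_on ?\<rho> (carrier (End_monoid ?P n)) \<and>
      (\<forall>f\<in>carrier (End_monoid ?P n). ?\<rho> (Invol ?P f) = Invol ?M (?\<rho> f))"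
  proof (intro allI conjI)
    fix n
    have sub: "carrier (End_monoid ?P n) \<subseteq> Mor ?P"
      using ObjP by (auto simp: End_monoid_def Mor_def)
    show "monoid (End_monoid ?P n)" by (rule monoid_End_monoid[OF P.category_axioms ObjP])
    show "monoid (End_monoid ?M (2 ^ n))" by (rule monoid_End_monoid[OF M.category_axioms ObjM])
    show "?\<rho> \<in> hom (End_monoid ?P n) (End_monoid ?M (2 ^ n))"
      using F_closed[OF ObjP ObjP, of _ n n] F_Comp[OF ObjP ObjP ObjP, of _ n n _ n]
      by (auto simp: hom_def End_monoid_def rho_obj_def)
    show "?\<rho> \<one>\<^bsub>End_monoid ?P n\<^esub> = \<one>\<^bsub>End_monoid ?M (2 ^ n)\<^esub>"
      using F_Id[OF ObjP, of n] by (simp add: End_monoid_def rho_obj_def)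
    show "inj_on ?\<rho> (carrier (End_monoid ?P n))" using inj sub by (rule inj_on_subset)
    show "\<forall>f\<in>carrier (End_monoid ?P n). ?\<rho> (Invol ?P f) = Invol ?M (?\<rho> f)"
      using invol sub by blast
  qed
  ultimately show ?thesis by (simp only: Let_def) blast
qed

end
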